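(* Let $A \in \mathbb{R}^{n\times n}$ be a hidden $Z$-matrix and let $q \in \mathbb{R}^n$. Assume that $A$ is an $E_0$-matrix, that every feasible basis of $\mathrm{FEA}(q,A)$ is non-degenerate, and that $\mathrm{LCP}(q,A)$ has a solution. Then $\mathrm{LCP}(q,A)$ has a unique solution, and this solution is non-degenerate.
   Context: All matrices are real, and vector inequalities are componentwise. A square matrix is a $Z$-matrix if all its off-diagonal entries are nonpositive. A matrix $A \in \mathbb{R}^{n\times n}$ is a hidden $Z$-matrix if there exist $Z$-matrices $X, Y \in \mathbb{R}^{n\times n}$ and vectors $r, s \in \mathbb{R}^n_+$ (nonnegative vectors) such that $AX = Y$ and $r^TX + s^TY > 0$. A matrix $A \in \mathbb{R}^{n\times n}$ is an $E_0$-matrix if for every $0 \neq x \geq 0$ in $\mathbb{R}^n$ there is an index $k$ with $x_k > 0$ and $(Ax)_k \geq 0$. For $q \in \mathbb{R}^n$, $\mathrm{FEA}(q,A) = \{z \in \mathbb{R}^n : z \geq 0,\ q + Az \geq 0\}$, and a solution of the linear complementarity problem $\mathrm{LCP}(q,A)$ is a vector $z \in \mathrm{FEA}(q,A)$ with $z^T(q+Az) = 0$. Writing $w = q + Az$, the feasible set is described by $w - Az = q$, $w \geq 0$, $z \geq 0$. A basis is a set of $n$ linearly independent columns of the $n \times 2n$ matrix $[\,I \;\; -A\,]$; it is feasible if the corresponding basic solution $(w,z)$ (the nonbasic variables being $0$) satisfies $w, z \geq 0$, and a feasible basis is non-degenerate if all $n$ of its basic variables are strictly positive in that basic solution. A solution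 $z$ of $\mathrm{LCP}(q,A)$ is non-degenerate if, with $w = q + Az$, we have $z + w > 0$, i.e. for each $i$ exactly one of $z_i, w_i$ is positive. *)

theory Defs
  imports "HOL-Analysis.Analysis"
begin

text \<open>
  Vectors in $R^n$ have type \<open>real ^ 'n\<close> and matrices type \<open>real ^ 'n ^ 'n\<close>. Strict vector
  inequalities are written out componentwise, because \<open><\<close> on \<open>real ^ 'n\<close> is only the strict part
  of the componentwise order \<open>\<le>\<close>.
\<close>

definition Z_matrix :: "real ^ 'n ^ 'n \<Rightarrow> bool" where
  "Z_matrix A \<longleftrightarrow> (\<forall>i j. i \<noteq> j \<longrightarrow> A $ i $ j \<le> 0)"

definition hidden_Z_matrix :: "real ^ 'n ^ 'n \<Rightarrow> bool" where
  "hidden_Z_matrix A \<longleftrightarrow>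
     (\<exists>X Y :: real ^ 'n ^ 'n. \<exists>r s :: real ^ 'n.
        Z_matrix X \<and> Z_matrix Y \<and> r \<ge> 0 \<and> s \<ge> 0 \<and> A ** X = Y \<and>
        (\<forall>j. (r v* X + s v* Y) $ j > 0))"

definition E0_matrix :: "real ^ 'n ^ 'n \<Rightarrow> bool" where
  "E0_matrix A \<longleftrightarrow> (\<forall>x. x \<noteq> 0 \<and> x \<ge> 0 \<longrightarrow> (\<exists>k. x $ k > 0 \<and> (A *v x) $ k \<ge> 0))"

definition FEA :: "real ^ 'n \<Rightarrow> real ^ 'n ^ 'n \<Rightarrow> (real ^ 'n) set" where
  "FEA q A = {z. z \<ge> 0 \<and> q + A *v z \<ge> 0}"

definition LCP_solution :: "real ^ 'n \<Rightarrow> real ^ 'n ^ 'n \<Rightarrow> real ^ 'n \<Rightarrow> bool" where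
  "LCP_solution q A z \<longleftrightarrow> z \<in> FEA q A \<and> z \<bullet> (q + A *v z) = 0"

definition nondegenerate_vector :: "real ^ 'n \<Rightarrow> real ^ 'n ^ 'n \<Rightarrow> real ^ 'n \<Rightarrow> bool" where
  "nondegenerate_vector q A z \<longleftrightarrow> (\<forall>i. (z + (q + A *v z)) $ i > 0)"

text \<open>
  The columns of the $n \times 2n$ matrix $[I \; {-A}]$ are indexed by \<open>'n + 'n\<close>: \<open>Inl i\<close> is the
  column of the variable $w_i$ and \<open>Inr i\<close> that of $z_i$.
\<close>

fun lcp_column :: "real ^ 'n ^ 'n \<Rightarrow> 'n + 'n \<Rightarrow> real ^ 'n" where
  "lcp_column A (Inl i) = column i (mat 1)"
| "lcp_column A (Inr i) = column i (- A)"

text \<open>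
  A basis is a set of column indices; injectivity makes the chosen columns linearly independent as
  a family, so that two equal columns are never chosen together.
\<close>

definition lcp_basis :: "real ^ 'n ^ 'n \<Rightarrow> ('n + 'n) set \<Rightarrow> bool" where
  "lcp_basis A B \<longleftrightarrow>
     card B = CARD('n) \<and> inj_on (lcp_column A) B \<and> independent (lcp_column A ` B)"

definition basic_solution ::
    "real ^ 'n \<Rightarrow> real ^ 'n ^ 'n \<Rightarrow> ('n + 'n) set \<Rightarrow> real ^ 'n \<Rightarrow> real ^ 'n \<Rightarrow> bool" where
  "basic_solution q A B w z \<longleftrightarrow>
     w - A *v z = q \<and> (\<forall>i. Inl i \<notin> B \<longrightarrow> w $ i = 0) \<and> (\<forall>i. Inr i \<notin> B \<longrightarrow> z $ i = 0)"

definition feasible_basis :: "real ^ 'n \<Rightarrow> real ^ 'n ^ 'n \<Rightarrow> ('n + 'n) set \<Rightarrow> bool" where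
  "feasible_basis q A B \<longleftrightarrow>
     lcp_basis A B \<and> (\<exists>w z. basic_solution q A B w z \<and> w \<ge> 0 \<and> z \<ge> 0)"

text \<open>A basis has exactly one basic solution, so the universal quantifier below is harmless.\<close>

definition nondegenerate_basis :: "real ^ 'n \<Rightarrow> real ^ 'n ^ 'n \<Rightarrow> ('n + 'n) set \<Rightarrow> bool" where
  "nondegenerate_basis q A B \<longleftrightarrow>
     (\<forall>w z. basic_solution q A B w z \<longrightarrow>
        (\<forall>i. Inl i \<in> B \<longrightarrow> w $ i > 0) \<and> (\<forall>i. Inr i \<in> B \<longrightarrow> z $ i > 0))"

end

theory Submission
  imports Defs
begin

text \<open>
  For small $t > 0$ the matrix $B = A + tI$ is again hidden Z, with the same $X$, and it is strictly
  semimonotone. Hence some $h > 0$ has $Bh > 0$, and the hidden Z structure turns $h$ into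
  $v \ge 0$ with $Xv = h$. This forces $B$ to be a P-matrix in the sense that $x_i (Bx)_i \le 0$ for
  all $i$ implies $x = 0$, so $\mathrm{LCP}(q,B)$ has at most one solution. Nondegeneracy of the
  feasible bases makes every solution of $\mathrm{LCP}(q,A)$ a nondegenerate vertex, which by Cramer's
  rule persists, with the same support, as a solution of $\mathrm{LCP}(q,B)$. Thus two solutions of
  $\mathrm{LCP}(q,A)$ have the same support, and the complementary basis determines them.
\<close>

section \<open>Z-matrices that map some nonnegative vector to a positive one\<close>

text \<open>A maximum principle: let \<open>k\<close> maximize \<open>x $ j / v $ j\<close>, with
  maximum \<open>m\<close>. In row \<open>k\<close> the diagonal terms of \<open>m v\<close> and
  \<open>x\<close> agree and the nonpositive off-diagonal entries reverse
  \<open>x $ j \<le> m * v $ j\<close>, so \<open>m * (M *v v) $ k\<close> is at most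
  \<open>(M *v x) $ k\<close>.\<close>

lemma Z_matrix_nonpos_if_mult_nonpos:
  fixes M :: "real ^ 'n ^ 'n"
  assumes Z: "Z_matrix M" and v: "\<And>i. 0 \<le> v $ i" and Mv: "\<And>i. 0 < (M *v v) $ i"
    and Mx: "\<And>i. (M *v x) $ i \<le> 0"
  shows "x $ i \<le> 0"
proof -
  have off: "M $ i $ j \<le> 0" if "j \<noteq> i" for i j
    using Z that by (auto simp: Z_matrix_def)
  \<comment> \<open>If \<open>v $ i = 0\<close>, row \<open>i\<close> of \<open>M *v v\<close> has
    only off-diagonal contributions, which are nonpositive.\<close>
  have vpos: "0 < v $ i" for i
  proof (rule ccontr)
    assume "\<not> 0 < v $ i"
    with v[of i] have "v $ i = 0" by simp
    then have "M $ i $ j * v $ j \<le> 0" for j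
      by (cases "j = i") (use off v in \<open>auto simp: mult_nonpos_nonneg\<close>)
    then have "(M *v v) $ i \<le> 0"
      by (simp add: matrix_vector_mult_def sum_nonpos)
    with Mv[of i] show False by simp
  qed
  define m where "m = Max (range (\<lambda>i. x $ i / v $ i))"
  have "m \<in> range (\<lambda>i. x $ i / v $ i)"
    unfolding m_def by (rule Max_in) auto
  then obtain k where k: "m = x $ k / v $ k" by auto
  have le: "x $ j \<le> m * v $ j" for j
  proof -
    have "x $ j / v $ j \<le> m" unfolding m_def by (rule Max_ge) auto
    then show ?thesis using vpos[of j] by (simp add: pos_divide_le_eq)
  qed
  have "m * (M *v v) $ k \<le> (M *v x) $ k"
    unfolding matrix_vector_mult_def sum_distrib_left vec_lambda_beta
  proof (rule sum_mono)
    fix j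
    show "m * (M $ k $ j * v $ j) \<le> M $ k $ j * x $ j"
    proof (cases "j = k")
      case True
      then show ?thesis using k vpos[of k] by simp
    next
      case False
      then show ?thesis using mult_left_mono_neg[OF le off, of j k j] by (simp add: mult_ac)
    qed
  qed
  also have "\<dots> \<le> 0" by (rule Mx)
  finally have "m \<le> 0"
    using Mv[of k] by (simp add: mult_le_0_iff)
  then show ?thesis
    using le[of i] vpos[of i] by (smt (verit) mult_nonpos_nonneg)
qed

lemma Z_matrix_kernel_trivial:
  fixes M :: "real ^ 'n ^ 'n"
  assumes "Z_matrix M" "\<And>i. 0 \<le> v $ i" "\<And>i. 0 < (M *v v) $ i" and "M *v x = 0"
  shows "x = 0"
proof -
  have "M *v (- x) = 0"
    using linear_neg[OF matrix_vector_mul_linear, of M x] assms(4) by simp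
  then have "x $ i \<le> 0" "(- x) $ i \<le> 0" for i
    using Z_matrix_nonpos_if_mult_nonpos[OF assms(1-3), of x i]
      Z_matrix_nonpos_if_mult_nonpos[OF assms(1-3), of "- x" i] assms(4)
    by (metis order_refl zero_index)+
  then show ?thesis by (simp add: vec_eq_iff antisym)
qed

section \<open>Strict semimonotonicity and a positive vector with positive image\<close>

text \<open>
  Brouwer's theorem solves the variational inequality of \<open>B\<close> on the standard simplex; at a solution
  \<open>x\<close> all entries of \<open>B x\<close> are at least \<open>x \<bullet> B x\<close>, with equality on the support of \<open>x\<close>.
\<close>

lemma strictly_semimonotone_imp_S:
  fixes B :: "real ^ 'n ^ 'n"
  assumes "\<And>x. x \<noteq> 0 \<Longrightarrow> 0 \<le> x \<Longrightarrow> \<exists>k. 0 < x $ k \<and> 0 < (B *v x) $ k"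
  obtains h where "\<And>i. 0 < h $ i" "\<And>i. 0 < (B *v h) $ i"
proof -
  define D :: "(real ^ 'n) set" where "D = {x. (\<forall>i. 0 \<le> x $ i) \<and> (\<Sum>i\<in>UNIV. x $ i) = 1}"
  have D_Int: "D = (\<Inter>i. {x. 0 \<le> x $ i}) \<inter> {x. (\<Sum>i\<in>UNIV. x $ i) = 1}"
    by (auto simp: D_def)
  have clD: "closed D"
    unfolding D_Int
    by (intro closed_Int closed_INT ballI closed_Collect_le closed_Collect_eq continuous_intros)
  have "D \<subseteq> cbox 0 1"
  proof
    fix x assume "x \<in> D"
    then have x: "0 \<le> x $ i" "(\<Sum>i\<in>UNIV. x $ i) = 1" for i by (auto simp: D_def)
    have "x $ i \<le> 1" for i
      using member_le_sum[of i UNIV "\<lambda>i. x $ i"] x by simp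
    with x show "x \<in> cbox 0 1" by (simp add: mem_box_cart)
  qed
  then have coD: "compact D"
    using clD bounded_cbox bounded_subset compact_eq_bounded_closed by blast
  have cvD: "convex D"
    unfolding convex_def D_def
    by (auto simp: sum.distrib sum_distrib_left[symmetric] intro!: add_nonneg_nonneg)
  have ax: "axis i 1 \<in> D" for i
    by (auto simp: D_def axis_def)
  then have neD: "D \<noteq> {}" by auto
  \<comment> \<open>Fixed points of this projected step are the solutions of the variational
    inequality.\<close>
  define F where "F x = closest_point D (x - B *v x)" for x
  have "continuous_on D F"
    unfolding F_def
    by (intro continuous_on_compose2[OF continuous_on_closest_point[OF cvD clD neD]]
        continuous_intros matrix_vector_mult_linear_continuous_on) auto
  moreover have "F \<in> D \<rightarrow> D"
    using clD neD by (auto simp: F_def closest_point_in_set)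
  ultimately obtain x where x: "x \<in> D" "F x = x"
    using brouwer[OF coD cvD neD] by blast
  have x0: "0 \<le> x $ i" and x1: "(\<Sum>i\<in>UNIV. x $ i) = 1" for i
    using x(1) by (auto simp: D_def)
  \<comment> \<open>The variational inequality is tested at the vertices of the simplex.\<close>
  have VI: "(B *v x) \<bullet> x \<le> (B *v x) $ i" for i
  proof -
    have "(x - B *v x - x) \<bullet> (axis i 1 - x) \<le> 0"
      using closest_point_dot[OF cvD clD ax, of "x - B *v x" i] x(2) unfolding F_def by simp
    then show ?thesis
      by (simp add: inner_diff_right inner_axis)
  qed
  \<comment> \<open>The average of the nonnegative gaps from \<open>VI\<close> with weights
    \<open>x $ i\<close> is zero, so each weighted gap vanishes.\<close>
  have eq: "(B *v x) $ k = (B *v x) \<bullet> x" if "0 < x $ k" for k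
  proof -
    have "(\<Sum>i\<in>UNIV. x $ i * ((B *v x) $ i - (B *v x) \<bullet> x))
        = (B *v x) \<bullet> x - (B *v x) \<bullet> x * (\<Sum>i\<in>UNIV. x $ i)"
      by (simp add: right_diff_distrib sum_subtractf sum_distrib_right[symmetric]
          inner_vec_def mult.commute)
    then have "(\<Sum>i\<in>UNIV. x $ i * ((B *v x) $ i - (B *v x) \<bullet> x)) = 0"
      by (simp add: x1)
    then have "x $ k * ((B *v x) $ k - (B *v x) \<bullet> x) = 0"
      using x0 VI by (subst (asm) sum_nonneg_eq_0_iff) auto
    with that show ?thesis by simp
  qed
  have "x \<noteq> 0" using x1 by auto
  moreover have "0 \<le> x" using x0 by (simp add: less_eq_vec_def)
  ultimately obtain k where "0 < x $ k" "0 < (B *v x) $ k"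
    using assms by blast
  then have pos: "0 < (B *v x) $ i" for i
    using eq VI[of i] by fastforce
  \<comment> \<open>So far \<open>x\<close> is only nonnegative; a small multiple of the all-ones
    vector makes it positive and keeps its image positive.\<close>
  have "((\<lambda>t. (B *v (x + t *\<^sub>R 1)) $ i) \<longlongrightarrow> (B *v (x + 0 *\<^sub>R 1)) $ i) (at_right 0)" for i
    by (simp only: matrix_vector_right_distrib matrix_vector_mult_scaleR) (intro tendsto_intros)
  then have "\<forall>\<^sub>F t in at_right 0. 0 < (B *v (x + t *\<^sub>R 1)) $ i" for i
    using pos[of i] by (intro order_tendstoD(1)[where y = "(B *v (x + 0 *\<^sub>R 1)) $ i"]) auto
  then have "\<forall>\<^sub>F t in at_right (0::real). (\<forall>i. 0 < (B *v (x + t *\<^sub>R 1)) $ i) \<and> 0 < t"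
    by (intro eventually_conj eventually_all_finite eventually_at_right_less) auto
  then obtain t where t: "0 < t" "\<And>i. 0 < (B *v (x + t *\<^sub>R 1)) $ i"
    by (metis (mono_tags, lifting) eventually_happens' trivial_limit_at_right_real)
  show ?thesis
    by (rule that[of "x + t *\<^sub>R 1"]) (use t x0 in \<open>auto intro: add_nonneg_pos\<close>)
qed

section \<open>Row mixtures and the hidden Z structure\<close>

text \<open>This is diag(a) M + diag(b) N. Mixing rows commutes with right multiplication, so a
  nonnegative mixture of \<open>mat 1\<close> and \<open>B\<close>, multiplied by \<open>X\<close>,
  is a mixture of the Z-matrices \<open>X\<close> and \<open>B ** X\<close>.\<close>

definition row_mix :: "real ^ 'n \<Rightarrow> real ^ 'n \<Rightarrow> real ^ 'n ^ 'n \<Rightarrow> real ^ 'n ^ 'n \<Rightarrow> real ^ 'n ^ 'n" where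
  "row_mix a b M N = (\<chi> i j. a $ i * M $ i $ j + b $ i * N $ i $ j)"

lemma row_mix_mult_vec:
  "(row_mix a b M N *v x) $ i = a $ i * (M *v x) $ i + b $ i * (N *v x) $ i"
  by (simp add: row_mix_def matrix_vector_mult_def sum_distrib_left sum.distrib distrib_right mult.assoc)

lemma row_mix_mult_mat: "row_mix a b M N ** X = row_mix a b (M ** X) (N ** X)"
  by (simp add: row_mix_def matrix_matrix_mult_def vec_eq_iff sum_distrib_left sum.distrib
      distrib_right mult.assoc)

lemma vec_mult_row_mix:
  "e v* row_mix a b M N = (\<chi> i. e $ i * a $ i) v* M + (\<chi> i. e $ i * b $ i) v* N"
  by (simp add: row_mix_def vector_matrix_mult_def vec_eq_iff sum.distrib distrib_left mult_ac)

lemma Z_matrix_row_mix: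
  assumes "Z_matrix M" "Z_matrix N" "\<And>i. 0 \<le> a $ i" "\<And>i. 0 \<le> b $ i"
  shows "Z_matrix (row_mix a b M N)"
  using assms by (auto simp: Z_matrix_def row_mix_def intro!: add_nonpos_nonpos mult_nonneg_nonpos)

lemma Z_matrix_invertible:
  fixes M :: "real ^ 'n ^ 'n"
  assumes "Z_matrix M" "\<And>i. 0 \<le> v $ i" "\<And>i. 0 < (M *v v) $ i"
  shows "invertible M"
  using Z_matrix_kernel_trivial[OF assms]
  by (simp add: invertible_left_inverse matrix_left_invertible_ker)

text \<open>
  The open convex cone of all \<open>p\<close> with \<open>p v* X > 0\<close> lies in the closed cone of the vectors
  \<open>a + y v* B\<close> with \<open>a, y \<ge> 0\<close>: their intersection is open because at such a point the matrix with
  rows \<open>a\<^sub>i e\<^sub>i + y\<^sub>i B\<^sub>i\<close> is invertible, so the cone condition survives small changes of \<open>p\<close>. Since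
  \<open>h\<close> is positive on the second cone, it is nonnegative on the first, that is, \<open>X\<^sup>-\<^sup>1 h \<ge> 0\<close>.
\<close>

lemma hidden_Z_nonneg_preimage:
  fixes B X :: "real ^ 'n ^ 'n"
  assumes ZX: "Z_matrix X" and ZY: "Z_matrix (B ** X)"
    and r: "\<And>i. 0 \<le> r $ i" and s: "\<And>i. 0 \<le> s $ i"
    and pos: "\<And>j. 0 < (r v* X + s v* (B ** X)) $ j"
    and h: "\<And>i. 0 < h $ i" and Bh: "\<And>i. 0 < (B *v h) $ i"
  obtains v where "\<And>i. 0 \<le> v $ i" "X *v v = h"
proof -
  define O' where "O' = {p. \<forall>j. 0 < (p v* X) $ j}"
  define cmb where "cmb = (\<lambda>(a, y). a + y v* B)"
  define K where "K = cmb ` ({a. \<forall>i. 0 \<le> a $ i} \<times> {y. \<forall>i. 0 \<le> y $ i})"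
  have cont_vm: "continuous_on S (\<lambda>p. p v* M)" for S and M :: "real ^ 'n ^ 'n"
    unfolding transpose_matrix_vector[symmetric] by (rule matrix_vector_mult_linear_continuous_on)
  have rs: "r + s v* B \<in> O' \<inter> K"
  proof
    show "r + s v* B \<in> O'"
      using pos by (simp add: O'_def vector_matrix_left_distrib vector_matrix_mul_assoc)
    show "r + s v* B \<in> K"
      unfolding K_def by (rule image_eqI[of _ _ "(r, s)"]) (use r s in \<open>auto simp: cmb_def\<close>)
  qed
  have cmb_h: "cmb (a, y) \<bullet> h = a \<bullet> h + y \<bullet> (B *v h)" for a y
    by (simp add: cmb_def inner_add_left dot_lmul_matrix)
  have K_nonneg: "0 \<le> p \<bullet> h" if p: "p \<in> K" for p
  proof -
    obtain a y where "p = cmb (a, y)" "\<And>i. 0 \<le> a $ i" "\<And>i. 0 \<le> y $ i"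
      using p by (auto simp: K_def)
    moreover from this have "p \<bullet> h = a \<bullet> h + y \<bullet> (B *v h)"
      by (simp add: cmb_h)
    ultimately show ?thesis
      using h Bh by (simp add: inner_vec_def add_nonneg_nonneg sum_nonneg less_imp_le)
  qed
  \<comment> \<open>The transpose of \<open>?N ** X\<close> is a Z-matrix sending the all-ones
    vector to \<open>cmb (a, y) v* X\<close>, which is positive; the determinant of the product then
    splits.\<close>
  have mix: "invertible (row_mix a y (mat 1) B)" "invertible X"
    if p: "cmb (a, y) \<in> O'" and a: "\<And>i. 0 \<le> a $ i" and y: "\<And>i. 0 \<le> y $ i" for a y
  proof -
    let ?N = "row_mix a y (mat 1) B"
    have C: "?N ** X = row_mix a y X (B ** X)"
      by (simp add: row_mix_mult_mat)
    have "Z_matrix (?N ** X)"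
      unfolding C by (intro Z_matrix_row_mix ZX ZY a y)
    then have "Z_matrix (transpose (?N ** X))"
      by (auto simp: Z_matrix_def transpose_def)
    moreover have "transpose (?N ** X) *v 1 = cmb (a, y) v* X"
      by (simp add: transpose_matrix_vector vector_matrix_mul_assoc[symmetric] vec_mult_row_mix cmb_def)
    ultimately have "invertible (transpose (?N ** X))"
      using p by (intro Z_matrix_invertible[of _ 1]) (auto simp: O'_def)
    then have "det ?N * det X \<noteq> 0"
      by (simp add: invertible_det_nz det_mul)
    then show "invertible ?N" "invertible X"
      by (auto simp: invertible_det_nz)
  qed
  have "open (O' \<inter> K)"
    unfolding open_subopen[of "O' \<inter> K"]
  proof
    fix p assume "p \<in> O' \<inter> K"
    then obtain a y where p: "p = cmb (a, y)" "cmb (a, y) \<in> O'"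
      and a: "\<And>i. 0 \<le> a $ i" and y: "\<And>i. 0 \<le> y $ i" by (auto simp: K_def)
    let ?N = "row_mix a y (mat 1) B"
    obtain L where L: "L ** ?N = mat 1" "?N ** L = mat 1"
      using mix(1)[OF p(2) a y] by (auto simp: invertible_def)
    \<comment> \<open>\<open>p' v* L\<close> gives the coefficients of \<open>p'\<close> in the rows
      of \<open>?N\<close>. They all equal 1 at \<open>p\<close>, and wherever they are nonnegative
      \<open>p'\<close> lies in \<open>K\<close>.\<close>
    define U where "U = {p. \<forall>i. 0 < (p v* L) $ i} \<inter> O'"
    have "open U"
      unfolding U_def O'_def Collect_all_eq
      by (intro open_Int open_INT ballI open_Collect_less continuous_intros cont_vm) auto
    moreover have "p = 1 v* ?N"
      by (simp add: p(1) vec_mult_row_mix cmb_def)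
    then have "p v* L = 1"
      by (simp add: vector_matrix_mul_assoc L)
    then have "p \<in> U" using p by (simp add: U_def)
    moreover have "U \<subseteq> K"
    proof
      fix p' assume "p' \<in> U"
      then have e: "0 \<le> (p' v* L) $ i" for i by (auto simp: U_def intro: less_imp_le)
      have "p' = p' v* L v* ?N"
        by (simp add: vector_matrix_mul_assoc L)
      also have "\<dots> = cmb (\<chi> i. (p' v* L) $ i * a $ i, \<chi> i. (p' v* L) $ i * y $ i)"
        by (simp add: vec_mult_row_mix cmb_def)
      finally show "p' \<in> K"
        using e a y by (auto simp: K_def)
    qed
    ultimately show "\<exists>T. open T \<and> p \<in> T \<and> T \<subseteq> O' \<inter> K"
      by (auto simp: U_def)
  qed
  moreover have "closed K"
    unfolding closed_sequential_limits
  proof (intro allI impI)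
    fix f l assume "(\<forall>n. f n \<in> K) \<and> f \<longlonglongrightarrow> l"
    then have fK: "f n \<in> K" and fl: "f \<longlonglongrightarrow> l" for n by auto
    \<comment> \<open>Near \<open>l\<close> the value
      \<open>a \<bullet> h + y \<bullet> (B *v h)\<close> stays below \<open>R\<close>. As
      \<open>h\<close> and \<open>B *v h\<close> are positive, this confines \<open>a\<close> and
      \<open>y\<close> to a compact box.\<close>
    define R where "R = l \<bullet> h + 1"
    define Q where "Q = cbox 0 (\<chi> i. R / h $ i) \<times> cbox 0 (\<chi> i. R / (B *v h) $ i)"
    have "compact (cmb ` Q)"
      unfolding Q_def cmb_def
      by (intro compact_continuous_image compact_Times compact_cbox)
        (auto simp: case_prod_beta intro!: continuous_intros continuous_on_compose2[OF cont_vm])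
    then have "closed (cmb ` Q)" by (rule compact_imp_closed)
    moreover have "\<forall>\<^sub>F n in sequentially. f n \<bullet> h < R"
      by (rule order_tendstoD(2)[OF tendsto_inner[OF fl tendsto_const]]) (simp add: R_def)
    then have "\<forall>\<^sub>F n in sequentially. f n \<in> cmb ` Q"
    proof eventually_elim
      case (elim n)
      obtain a y where f: "f n = cmb (a, y)"
        and a: "\<And>i. 0 \<le> a $ i" and y: "\<And>i. 0 \<le> y $ i"
        using fK[of n] by (auto simp: K_def)
      have nn: "0 \<le> a $ i * h $ i" "0 \<le> y $ i * (B *v h) $ i" for i
        using a y h Bh by (simp_all add: less_imp_le)
      have "a \<bullet> h + y \<bullet> (B *v h) < R"
        using elim by (simp add: f cmb_h)
      moreover have "a $ i * h $ i \<le> a \<bullet> h" "y $ i * (B *v h) $ i \<le> y \<bullet> (B *v h)" for i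
        unfolding inner_vec_def by (auto intro!: member_le_sum nn simp: nn)
      moreover have "0 \<le> a \<bullet> h" "0 \<le> y \<bullet> (B *v h)"
        unfolding inner_vec_def by (auto intro!: sum_nonneg simp: nn)
      ultimately have "a $ i * h $ i \<le> R" "y $ i * (B *v h) $ i \<le> R" for i
        by (smt (verit))+
      then have "(a, y) \<in> Q"
        using a y h Bh by (simp add: Q_def mem_box_cart pos_le_divide_eq)
      then show ?case by (auto simp: f)
    qed
    ultimately have "l \<in> cmb ` Q"
      using fl by (auto intro: Lim_in_closed_set)
    moreover have "cmb ` Q \<subseteq> K"
      by (auto simp: Q_def K_def mem_box_cart)
    ultimately show "l \<in> K" by blast
  qed
  moreover have "connected O'"
  proof (rule convex_connected, rule convexI)
    fix p p' and c d :: real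
    assume p: "p \<in> O'" "p' \<in> O'" and cd: "0 \<le> c" "0 \<le> d" "c + d = 1"
    show "c *\<^sub>R p + d *\<^sub>R p' \<in> O'"
      unfolding O'_def
    proof (intro CollectI allI)
      fix j
      have pos: "0 < (p v* X) $ j" "0 < (p' v* X) $ j" using p by (auto simp: O'_def)
      have "0 < c * (p v* X) $ j + d * (p' v* X) $ j"
        using pos cd by (cases "c = 0") (auto intro: add_pos_nonneg)
      then show "0 < ((c *\<^sub>R p + d *\<^sub>R p') v* X) $ j"
        by (simp add: vector_matrix_mult_def sum_distrib_left sum.distrib distrib_left mult_ac)
    qed
  qed
  \<comment> \<open>The intersection is nonempty, open and closed relative to the connected set
    \<open>O'\<close>.\<close>
  ultimately have "O' \<inter> K = O'"
    using rs openin_open_Int[of "O' \<inter> K" O'] closedin_closed_Int[of K O']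
    unfolding connected_clopen by (metis Int_left_absorb empty_iff)
  then have OK: "O' \<subseteq> K" by blast
  obtain L where L: "L ** X = mat 1" "X ** L = mat 1"
    using mix(2)[of r s] rs r s by (auto simp: invertible_def cmb_def)
  have g: "0 \<le> g \<bullet> (L *v h)" if "\<And>i. 0 < g $ i" for g
  proof -
    have "g v* L \<in> O'"
      using that by (simp add: O'_def vector_matrix_mul_assoc L)
    then show ?thesis
      using OK K_nonneg[of "g v* L"] by (auto simp: dot_lmul_matrix)
  qed
  show ?thesis
  proof (rule that)
    show "X *v (L *v h) = h"
      by (simp add: matrix_vector_mul_assoc L)
    fix i
    \<comment> \<open>\<open>g\<close> requires strictly positive vectors, so the unit vector is
      approached from inside the orthant.\<close>
    have "((\<lambda>t. (axis i 1 + t *\<^sub>R 1) \<bullet> (L *v h)) \<longlongrightarrow> (axis i 1 + 0 *\<^sub>R 1) \<bullet> (L *v h)) (at_right 0)"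
      by (intro tendsto_intros)
    moreover have "\<forall>\<^sub>F t in at_right 0. 0 \<le> (axis i 1 + t *\<^sub>R 1) \<bullet> (L *v h)"
      using eventually_at_right_less[of "0::real"]
      by eventually_elim (rule g, auto simp: axis_def)
    ultimately have "0 \<le> (axis i 1 + 0 *\<^sub>R 1) \<bullet> (L *v h)"
      by (rule tendsto_lowerbound) simp
    then show "0 \<le> (L *v h) $ i"
      by (simp add: inner_axis')
  qed
qed

text \<open>
  A sign-reversed vector \<open>x = X u\<close> puts \<open>u\<close> in the kernel of a nonnegative row mixture of \<open>X\<close> and
  \<open>B X\<close>, which is a Z-matrix mapping \<open>v\<close> to a positive vector.
\<close>

lemma hidden_Z_no_sign_reversal:
  fixes B X :: "real ^ 'n ^ 'n"
  assumes ZX: "Z_matrix X" and ZY: "Z_matrix (B ** X)"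
    and v: "\<And>i. 0 \<le> v $ i" "\<And>i. 0 < (X *v v) $ i" "\<And>i. 0 < (B *v (X *v v)) $ i"
    and x: "\<And>i. x $ i * (B *v x) $ i \<le> 0"
  shows "x = 0"
proof -
  obtain L where "X ** L = mat 1"
    using Z_matrix_invertible[OF ZX v(1,2)] by (auto simp: invertible_def)
  then obtain u where u: "X *v u = x"
    by (metis matrix_vector_mul_assoc matrix_vector_mul_lid)
  \<comment> \<open>Where \<open>x $ i\<close> and \<open>(B *v x) $ i\<close> have opposite signs,
    these weights cancel them. The value 1 at \<open>x $ i = 0\<close> keeps row \<open>i\<close> of
    \<open>?C *v v\<close> positive, since \<open>b $ i = 0\<close> there.\<close>
  define a b :: "real ^ 'n" where "a = (\<chi> i. if x $ i = 0 then 1 else \<bar>(B *v x) $ i\<bar>)"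
    and "b = (\<chi> i. \<bar>x $ i\<bar>)"
  let ?C = "row_mix a b X (B ** X)"
  have Cw: "(?C *v w) $ i = a $ i * (X *v w) $ i + b $ i * (B *v (X *v w)) $ i" for w i
    by (simp add: row_mix_mult_vec matrix_vector_mul_assoc)
  have Z: "Z_matrix ?C"
    by (intro Z_matrix_row_mix ZX ZY) (auto simp: a_def b_def)
  have pos: "0 < (?C *v v) $ i" for i
    unfolding Cw using v(2)[of i] v(3)[of i]
    by (auto simp: a_def b_def intro: add_nonneg_pos)
  have "?C *v u = 0"
    unfolding vec_eq_iff
  proof
    fix i
    show "(?C *v u) $ i = 0 $ i"
      unfolding Cw u using x[of i] by (auto simp: a_def b_def abs_if mult_le_0_iff)
  qed
  then have "u = 0"
    by (rule Z_matrix_kernel_trivial[OF Z v(1) pos])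
  then show ?thesis using u by simp
qed

section \<open>Independent families, conic Caratheodory and bases of [I -A]\<close>

lemma independent_family_iff:
  fixes f :: "'i \<Rightarrow> 'a::real_vector"
  assumes fin: "finite S"
  shows "inj_on f S \<and> independent (f ` S) \<longleftrightarrow>
    (\<forall>c. (\<Sum>i\<in>S. c i *\<^sub>R f i) = 0 \<longrightarrow> (\<forall>i\<in>S. c i = 0))" (is "?L \<longleftrightarrow> ?R")
proof
  assume L: ?L
  show ?R
  proof (intro allI impI ballI)
    fix c i assume c: "(\<Sum>i\<in>S. c i *\<^sub>R f i) = 0" and i: "i \<in> S"
    have "(\<Sum>v\<in>f ` S. c (inv_into S f v) *\<^sub>R v) = 0"
      using L c by (simp add: sum.reindex)
    then have "c (inv_into S f (f i)) = 0"
      using L i fin by (intro independentD[of "f ` S" "f ` S" "\<lambda>v. c (inv_into S f v)"]) auto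
    then show "c i = 0" using L i by simp
  qed
next
  assume R: ?R
  have inj: "inj_on f S"
  proof (rule inj_onI, rule ccontr)
    fix i j assume ij: "i \<in> S" "j \<in> S" "f i = f j" "i \<noteq> j"
    define c :: "'i \<Rightarrow> real" where "c = (\<lambda>k. (if k = i then 1 else 0) - (if k = j then 1 else 0))"
    have "(\<Sum>k\<in>S. c k *\<^sub>R f k) = (\<Sum>k\<in>S. (if k = i then f k else 0) - (if k = j then f k else 0))"
      by (rule sum.cong) (auto simp: c_def)
    also have "\<dots> = 0"
      using ij fin by (simp add: sum_subtractf)
    finally have "c i = 0" using R ij by blast
    then show False using ij by (simp add: c_def)
  qed
  moreover have "independent (f ` S)"
  proof (rule independent_if_scalars_zero)
    fix g x assume "(\<Sum>x\<in>f ` S. g x *\<^sub>R x) = 0" "x \<in> f ` S"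
    then show "g x = 0"
      using R[rule_format, of "\<lambda>i. g (f i)"] inj by (auto simp: sum.reindex)
  qed (use fin in simp)
  ultimately show ?L by blast
qed

text \<open>While the family is dependent, subtracting a suitable multiple of a dependence makes one
  coefficient vanish and keeps the others nonnegative; induction on the number of vectors
  finishes.\<close>

lemma conic_caratheodory:
  fixes f :: "'i \<Rightarrow> 'a::real_vector"
  assumes "finite S" "\<And>i. i \<in> S \<Longrightarrow> 0 \<le> u i"
  shows "\<exists>T u'. T \<subseteq> S \<and> inj_on f T \<and> independent (f ` T) \<and> (\<forall>i\<in>T. 0 \<le> u' i) \<and>
    (\<Sum>i\<in>T. u' i *\<^sub>R f i) = (\<Sum>i\<in>S. u i *\<^sub>R f i)"
  using assms
proof (induction "card S" arbitrary: S u rule: less_induct)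
  case less
  show ?case
  proof (cases "inj_on f S \<and> independent (f ` S)")
    case True
    then show ?thesis using less.prems by blast
  next
    case False
    then obtain c i where c: "(\<Sum>i\<in>S. c i *\<^sub>R f i) = 0" "i \<in> S" "c i \<noteq> 0"
      using independent_family_iff[OF less.prems(1)] by blast
    obtain d where d: "(\<Sum>i\<in>S. d i *\<^sub>R f i) = 0" "0 < d i"
    proof (cases "0 < c i")
      case True
      with c that show ?thesis by blast
    next
      case False
      with c that[of "\<lambda>i. - c i"] show ?thesis by (simp add: sum_negf)
    qed
    define P where "P = {i \<in> S. 0 < d i}"
    have "finite P" "P \<noteq> {}" using less.prems(1) c d by (auto simp: P_def)
    then obtain k where k: "k \<in> P" "\<And>j. j \<in> P \<Longrightarrow> u k / d k \<le> u j / d j"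
      using ex_min_if_finite[of "(\<lambda>i. u i / d i) ` P"] by (fastforce simp: not_less)
    \<comment> \<open>The ratio test of the simplex method: the largest step along \<open>d\<close>
      that keeps all coefficients nonnegative.\<close>
    define t where "t = u k / d k"
    define u' where "u' = (\<lambda>i. u i - t * d i)"
    have kS: "k \<in> S" "0 < d k" using k by (auto simp: P_def)
    have t: "0 \<le> t" using kS less.prems(2) by (simp add: t_def)
    have uk: "u' k = 0" using kS by (simp add: u'_def t_def)
    have nn: "0 \<le> u' i" if "i \<in> S" for i
    proof (cases "0 < d i")
      case True
      then have "t \<le> u i / d i" using k that by (simp add: P_def t_def)
      with True show ?thesis by (simp add: u'_def pos_le_divide_eq)
    next
      case False
      then have "t * d i \<le> 0" using t by (simp add: mult_nonneg_nonpos)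
      with less.prems(2)[OF that] show ?thesis by (simp add: u'_def)
    qed
    have "(\<Sum>i\<in>S. u' i *\<^sub>R f i) = (\<Sum>i\<in>S. u i *\<^sub>R f i) - t *\<^sub>R (\<Sum>i\<in>S. d i *\<^sub>R f i)"
      by (simp add: u'_def scaleR_diff_left sum_subtractf scaleR_sum_right)
    then have eq: "(\<Sum>i\<in>S - {k}. u' i *\<^sub>R f i) = (\<Sum>i\<in>S. u i *\<^sub>R f i)"
      using uk d less.prems(1) kS by (simp add: sum.remove)
    have "card (S - {k}) < card S"
      using less.prems(1) kS(1) by (rule card_Diff1_less)
    then have "\<exists>T w. T \<subseteq> S - {k} \<and> inj_on f T \<and> independent (f ` T) \<and> (\<forall>i\<in>T. 0 \<le> w i) \<and>
        (\<Sum>i\<in>T. w i *\<^sub>R f i) = (\<Sum>i\<in>S - {k}. u' i *\<^sub>R f i)"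
      by (rule less.hyps) (use less.prems(1) nn in auto)
    then show ?thesis
      unfolding eq by blast
  qed
qed

lemma independent_family_extend:
  fixes f :: "'i \<Rightarrow> 'a::real_vector"
  assumes inj: "inj_on f T" and ind: "independent (f ` T)"
  obtains B where "T \<subseteq> B" "inj_on f B" "independent (f ` B)" "range f \<subseteq> span (f ` B)"
proof -
  obtain D where D: "f ` T \<subseteq> D" "D \<subseteq> range f" "independent D" "range f \<subseteq> span D"
    using maximal_independent_subset_extend[of "f ` T" "range f"] ind by blast
  \<comment> \<open>One preimage is chosen for each new vector only, so \<open>f\<close> stays
    injective on the enlarged index set.\<close>
  define B where "B = T \<union> inv f ` (D - f ` T)"
  have g: "f (inv f y) = y" if "y \<in> D" for y
    using D(2) that by (auto intro: f_inv_into_f)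
  have "f ` B = D"
    using D(1) g by (auto simp: B_def image_Un image_image intro: rev_image_eqI)
  moreover have "inj_on f B"
    unfolding B_def using inj g by (fastforce simp: inj_on_def)
  ultimately show ?thesis
    using D by (intro that[of B]) (auto simp: B_def)
qed

lemma sum_lcp_column:
  "(\<Sum>c\<in>UNIV. u c *\<^sub>R lcp_column A c) = (\<chi> i. u (Inl i)) - A *v (\<chi> i. u (Inr i))"
proof -
  have "(\<Sum>c\<in>UNIV. u c *\<^sub>R lcp_column A c)
      = (\<Sum>i\<in>UNIV. u (Inl i) *\<^sub>R column i (mat 1)) + (\<Sum>i\<in>UNIV. u (Inr i) *\<^sub>R column i (- A))"
    by (simp add: UNIV_Plus_UNIV[symmetric] sum.Plus del: UNIV_Plus_UNIV)
  also have "\<dots> = mat 1 *v (\<chi> i. u (Inl i)) + (- A) *v (\<chi> i. u (Inr i))"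
    unfolding matrix_mult_sum by (simp add: scalar_mult_eq_scaleR)
  also have "(- A) *v (\<chi> i. u (Inr i)) = - (A *v (\<chi> i. u (Inr i)))"
    by (simp add: vec_eq_iff matrix_vector_mult_def sum_negf)
  finally show ?thesis by simp
qed

text \<open>The columns of the \<open>w\<close> variables already span the whole space, so a maximal
  independent family of columns has exactly n members.\<close>

lemma lcp_basis_extend:
  fixes A :: "real ^ 'n ^ 'n"
  assumes "inj_on (lcp_column A) T" "independent (lcp_column A ` T)"
  obtains B where "T \<subseteq> B" "lcp_basis A B"
proof -
  obtain B where B: "T \<subseteq> B" "inj_on (lcp_column A) B" "independent (lcp_column A ` B)"
    "range (lcp_column A) \<subseteq> span (lcp_column A ` B)"
    using independent_family_extend[OF assms] by blast
  have "x \<in> span (range (lcp_column A))" for x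
  proof -
    have "x = (\<Sum>c\<in>UNIV. case_sum (($) x) (\<lambda>_. 0) c *\<^sub>R lcp_column A c)"
      unfolding sum_lcp_column by (simp add: vec_eq_iff matrix_vector_mult_def)
    also have "\<dots> \<in> span (range (lcp_column A))"
      by (intro span_sum span_scale span_base) auto
    finally show ?thesis .
  qed
  then have "UNIV \<subseteq> span (lcp_column A ` B)"
    using span_minimal[OF B(4) subspace_span] by blast
  then have "card (lcp_column A ` B) = CARD('n)"
    using basis_card_eq_dim[OF subset_UNIV _ B(3)] by simp
  then show ?thesis
    using B by (intro that[of B]) (auto simp: lcp_basis_def card_image)
qed

section \<open>Complementary bases and solutions as nondegenerate vertices\<close>

text \<open>The submatrix of [I -A] that takes the column of \<open>z\<close> at indices in
  \<open>\<alpha>\<close> and that of \<open>w\<close> elsewhere.\<close>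

definition complementary_matrix :: "'n set \<Rightarrow> real ^ 'n ^ 'n \<Rightarrow> real ^ 'n ^ 'n" where
  "complementary_matrix \<alpha> A = (\<chi> i j. if j \<in> \<alpha> then - A $ i $ j else mat 1 $ i $ j)"

lemma complementary_matrix_mult:
  "complementary_matrix \<alpha> A *v y =
    (\<chi> j. if j \<in> \<alpha> then 0 else y $ j) - A *v (\<chi> j. if j \<in> \<alpha> then y $ j else 0)"
proof -
  have "complementary_matrix \<alpha> A *v y =
      mat 1 *v (\<chi> j. if j \<in> \<alpha> then 0 else y $ j) - A *v (\<chi> j. if j \<in> \<alpha> then y $ j else 0)"
    by (auto simp: vec_eq_iff matrix_vector_mult_def complementary_matrix_def
        sum_subtractf[symmetric] intro!: sum.cong simp del: matrix_vector_mul_lid)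
  then show ?thesis by simp
qed

lemma LCP_solutionD:
  assumes "LCP_solution q A z"
  shows "0 \<le> z $ i" "0 \<le> (q + A *v z) $ i" "z $ i * (q + A *v z) $ i = 0"
proof -
  have nn: "0 \<le> z $ i" "0 \<le> (q + A *v z) $ i" for i
    using assms unfolding LCP_solution_def FEA_def by (auto simp: less_eq_vec_def)
  then show "0 \<le> z $ i" "0 \<le> (q + A *v z) $ i" by auto
  have "(\<Sum>i\<in>UNIV. z $ i * (q + A *v z) $ i) = 0"
    using assms by (simp add: LCP_solution_def inner_vec_def)
  then show "z $ i * (q + A *v z) $ i = 0"
    using nn by (subst (asm) sum_nonneg_eq_0_iff) auto
qed

text \<open>
  If the columns in the support of a solution were dependent, conic Caratheodory would give a
  feasible basic solution with fewer than \<open>n\<close> positive variables, hence a degenerate basis.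
\<close>

lemma LCP_solution_vertex:
  fixes A :: "real ^ 'n ^ 'n"
  assumes nd: "\<And>B. feasible_basis q A B \<Longrightarrow> nondegenerate_basis q A B"
    and z: "LCP_solution q A z"
  shows "nondegenerate_vector q A z" and "invertible (complementary_matrix {j. 0 < z $ j} A)"
proof -
  define w where "w = q + A *v z"
  note sol = LCP_solutionD[OF z, folded w_def]
  define u where "u = case_sum (($) w) (($) z)"
  define S where "S = {c. 0 < u c}"
  let ?f = "lcp_column A"
  \<comment> \<open>Forgets whether a variable belongs to \<open>w\<close> or to \<open>z\<close>;
    complementarity will make it injective on \<open>S\<close>.\<close>
  let ?p = "case_sum id id :: 'n + 'n \<Rightarrow> 'n"
  have u0: "0 \<le> u c" for c using sol by (cases c) (auto simp: u_def)
  have "(\<Sum>c\<in>S. u c *\<^sub>R ?f c) = (\<Sum>c\<in>UNIV. u c *\<^sub>R ?f c)"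
    by (rule sum.mono_neutral_left) (use u0 in \<open>auto simp: S_def order.order_iff_strict\<close>)
  also have "\<dots> = q"
    unfolding sum_lcp_column by (simp add: u_def w_def vec_eq_iff)
  finally have uq: "(\<Sum>c\<in>S. u c *\<^sub>R ?f c) = q" .
  obtain T u' where T: "T \<subseteq> S" "inj_on ?f T" "independent (?f ` T)" "\<forall>c\<in>T. 0 \<le> u' c"
    and u'q: "(\<Sum>c\<in>T. u' c *\<^sub>R ?f c) = q"
    using conic_caratheodory[of S u ?f] u0 uq by auto
  obtain B where B: "T \<subseteq> B" "lcp_basis A B"
    using lcp_basis_extend[OF T(2,3)] .
  define x where "x = (\<lambda>c. if c \<in> T then u' c else 0)"
  have "(\<Sum>c\<in>T. u' c *\<^sub>R ?f c) = (\<Sum>c\<in>UNIV. x c *\<^sub>R ?f c)"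
    by (rule sum.mono_neutral_cong_left) (auto simp: x_def)
  then have bs: "basic_solution q A B (\<chi> i. x (Inl i)) (\<chi> i. x (Inr i))"
    using u'q B(1) by (auto simp: basic_solution_def sum_lcp_column x_def)
  moreover have "feasible_basis q A B"
    unfolding feasible_basis_def
    using B(2) bs T(4) by (force simp: less_eq_vec_def x_def)
  ultimately have pos: "(\<forall>i. Inl i \<in> B \<longrightarrow> 0 < x (Inl i)) \<and> (\<forall>i. Inr i \<in> B \<longrightarrow> 0 < x (Inr i))"
    using nd unfolding nondegenerate_basis_def by fastforce
  \<comment> \<open>Nondegeneracy makes every variable of \<open>B\<close> positive, hence B lies in
    \<open>T\<close> and so in \<open>S\<close>. As \<open>S\<close> has at most n elements,
    \<open>S = B\<close>, and each index carries a positive variable.\<close>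
  have "B \<subseteq> T"
  proof
    fix c assume "c \<in> B"
    with pos have "0 < x c" by (cases c) auto
    then show "c \<in> T" by (auto simp: x_def split: if_splits)
  qed
  with B T(1) have BS: "B \<subseteq> S" by blast
  have S_eq: "Inl i \<in> S \<longleftrightarrow> 0 < w $ i" "Inr i \<in> S \<longleftrightarrow> 0 < z $ i" for i
    by (auto simp: S_def u_def)
  have disj: "\<not> (0 < w $ i \<and> 0 < z $ i)" for i
    using sol(3)[of i] by auto
  have injp: "inj_on ?p S"
  proof (rule inj_onI)
    fix c d
    assume "c \<in> S" "d \<in> S" "?p c = ?p d"
    then show "c = d"
      using disj by (cases c; cases d) (auto simp: S_eq)
  qed
  have cardB: "card B = CARD('n)" using B(2) by (simp add: lcp_basis_def)
  have "card S \<le> CARD('n)"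
    using card_inj_on_le[OF injp subset_UNIV] by simp
  then have SB: "S = B"
    using BS cardB by (metis card_seteq finite)
  have img: "?p ` S = UNIV"
    using injp cardB SB by (intro card_subset_eq) (auto simp: card_image)
  have alt: "0 < z $ i \<or> 0 < w $ i" for i
  proof -
    have "i \<in> ?p ` S" by (simp only: img UNIV_I)
    then obtain c where "c \<in> S" "?p c = i" by (elim imageE) simp
    then show ?thesis by (cases c) (auto simp: S_eq)
  qed
  show "nondegenerate_vector q A z"
    unfolding nondegenerate_vector_def w_def[symmetric]
  proof
    fix i
    show "0 < (z + w) $ i" using alt[of i] sol(1,2)[of i] by auto
  qed
  let ?M = "complementary_matrix {j. 0 < z $ j} A"
  have "y = 0" if y: "?M *v y = 0" for y
  proof -
    \<comment> \<open>Spreads \<open>y\<close> over the columns selected by \<open>?M\<close>, which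
      are exactly those in \<open>S\<close>.\<close>
    define c where "c = case_sum (\<lambda>j. if 0 < z $ j then 0 else y $ j)
      (\<lambda>j. if 0 < z $ j then y $ j else 0)"
    have "(\<Sum>k\<in>S. c k *\<^sub>R ?f k) = (\<Sum>k\<in>UNIV. c k *\<^sub>R ?f k)"
    proof (rule sum.mono_neutral_left)
      show "\<forall>k\<in>UNIV - S. c k *\<^sub>R ?f k = 0"
      proof
        fix k assume "k \<in> UNIV - S"
        then have "c k = 0" using alt by (cases k) (auto simp: c_def S_eq)
        then show "c k *\<^sub>R ?f k = 0" by simp
      qed
    qed auto
    also have "\<dots> = 0"
      unfolding sum_lcp_column using y by (simp add: c_def complementary_matrix_mult)
    finally have "(\<Sum>k\<in>S. c k *\<^sub>R ?f k) = 0" .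
    moreover have "inj_on ?f S \<and> independent (?f ` S)"
      using B(2) SB by (simp add: lcp_basis_def)
    ultimately have c0: "\<forall>k\<in>S. c k = 0"
      by (simp add: independent_family_iff)
    have "y $ j = 0" for j
      using alt[of j] bspec[OF c0, of "Inl j"] bspec[OF c0, of "Inr j"]
      by (cases "0 < z $ j") (auto simp: S_eq c_def)
    then show ?thesis by (simp add: vec_eq_iff)
  qed
  then show "invertible ?M"
    by (simp add: invertible_left_inverse matrix_left_invertible_ker)
qed

section \<open>Perturbation to A + tI and uniqueness\<close>

text \<open>Cramer's rule writes the solution as quotients of determinants, which converge because
  the limit determinant is nonzero; finitely many strict inequalities then persist.\<close>

lemma eventually_perturbed_system_pos:
  fixes M :: "real ^ 'n ^ 'n"
  assumes inv: "invertible M" and Mu: "M *v u = q" and u: "\<And>i. 0 < u $ i"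
    and G: "(G \<longlongrightarrow> M) F"
  shows "\<forall>\<^sub>F t in F. \<exists>y. G t *v y = q \<and> (\<forall>i. 0 < y $ i)"
proof -
  have lim_det: "((\<lambda>t. det (H t)) \<longlongrightarrow> det N) F" if "\<And>i j. ((\<lambda>t. H t $ i $ j) \<longlongrightarrow> N $ i $ j) F"
    for H and N :: "real ^ 'n ^ 'n"
    unfolding det_def by (intro tendsto_intros that)
  have Gij: "((\<lambda>t. G t $ i $ j) \<longlongrightarrow> M $ i $ j) F" for i j
    by (intro tendsto_intros G)
  have d0: "det M \<noteq> 0" using inv by (simp add: invertible_det_nz)
  define Y
    where "Y N = (\<chi> k. det (\<chi> i j. if j = k then q $ i else N $ i $ j) / det N)" for N :: "real ^ 'n ^ 'n"
  have Y: "N *v Y N = q" "N *v x = q \<Longrightarrow> x = Y N" if "det N \<noteq> 0" for N x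
    using cramer[OF that] by (auto simp: Y_def)
  have lim: "((\<lambda>t. Y (G t) $ k) \<longlongrightarrow> Y M $ k) F" for k
    unfolding Y_def vec_lambda_beta
    by (intro tendsto_divide lim_det Gij d0) (auto intro: Gij)
  have "\<forall>\<^sub>F t in F. \<forall>k. 0 < Y (G t) $ k"
    using u Y(2)[OF d0 Mu] by (intro eventually_all_finite order_tendstoD(1)[OF lim]) auto
  moreover have "\<forall>\<^sub>F t in F. det (G t) \<noteq> 0"
    using tendsto_imp_eventually_ne[OF lim_det[OF Gij] d0] .
  ultimately show ?thesis
    by eventually_elim (use Y in blast)
qed

theorem theorem3p7:
  fixes A :: "real ^ 'n ^ 'n" and q :: "real ^ 'n"
  assumes "hidden_Z_matrix A"
    and "E0_matrix A"
    and "\<And>B. feasible_basis q A B \<Longrightarrow> nondegenerate_basis q A B"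
    and "\<exists>z. LCP_solution q A z"
  shows "(\<exists>!z. LCP_solution q A z) \<and>
         (\<forall>z. LCP_solution q A z \<longrightarrow> nondegenerate_vector q A z)"
proof -
  obtain X r s where ZX: "Z_matrix X" and ZY: "Z_matrix (A ** X)"
    and r: "\<And>i. 0 \<le> r $ i" and s: "\<And>i. 0 \<le> s $ i"
    and pos: "\<And>j. 0 < (r v* X + s v* (A ** X)) $ j"
    using assms(1) unfolding hidden_Z_matrix_def by (auto simp: less_eq_vec_def)
  define B where "B t = A + t *\<^sub>R mat 1" for t :: real
  have B_mult: "B t *v x = A *v x + t *\<^sub>R x" for t x
    by (simp add: B_def matrix_vector_mult_add_rdistrib scaleR_matrix_vector_assoc[symmetric])
  have B_X: "B t ** X = A ** X + t *\<^sub>R X" for t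
    by (simp add: matrix_eq matrix_vector_mul_assoc[symmetric] B_mult
        matrix_vector_mult_add_rdistrib scaleR_matrix_vector_assoc[symmetric])
  have B_lim: "((\<lambda>t. B t $ i $ j) \<longlongrightarrow> A $ i $ j) (at_right 0)" for i j
  proof -
    have "((\<lambda>t. A $ i $ j + t * mat 1 $ i $ j) \<longlongrightarrow> A $ i $ j + 0 * mat 1 $ i $ j) (at_right 0)"
      by (intro tendsto_intros)
    then show ?thesis by (simp add: B_def)
  qed
  \<comment> \<open>The same \<open>r\<close> and \<open>s\<close> certify the hidden Z property for
    small \<open>t\<close>.\<close>
  have pos_B: "\<forall>\<^sub>F t in at_right 0. \<forall>j. 0 < (r v* X + s v* (B t ** X)) $ j"
  proof (intro eventually_all_finite)
    fix j
    have "((\<lambda>t. (r v* X + s v* (A ** X)) $ j + t * (s v* X) $ j)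
        \<longlongrightarrow> (r v* X + s v* (A ** X)) $ j + 0 * (s v* X) $ j) (at_right 0)"
      by (intro tendsto_intros)
    then have "\<forall>\<^sub>F t in at_right 0. 0 < (r v* X + s v* (A ** X)) $ j + t * (s v* X) $ j"
      by (rule order_tendstoD(1)) (use pos in simp)
    moreover have "(s v* (B t ** X)) $ j = (s v* (A ** X)) $ j + t * (s v* X) $ j" for t
      by (simp add: B_X vector_matrix_mult_def distrib_left sum.distrib sum_distrib_left mult_ac)
    ultimately show "\<forall>\<^sub>F t in at_right 0. 0 < (r v* X + s v* (B t ** X)) $ j"
      by (simp add: add.assoc)
  qed
  have no_reversal: "x = 0"
    if t: "0 < t" and pos': "\<And>j. 0 < (r v* X + s v* (B t ** X)) $ j"
      and x: "\<And>i. x $ i * (B t *v x) $ i \<le> 0" for t x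
  proof -
    \<comment> \<open>The extra term \<open>t * x $ k\<close> turns the weak inequality of the E0
      property into a strict one.\<close>
    have semi: "\<exists>k. 0 < x $ k \<and> 0 < (B t *v x) $ k" if x: "x \<noteq> 0" "0 \<le> x" for x
    proof -
      obtain k where "0 < x $ k" "0 \<le> (A *v x) $ k"
        using assms(2) x unfolding E0_matrix_def by blast
      then show ?thesis
        using t by (auto simp: B_mult intro!: exI[of _ k] add_nonneg_pos)
    qed
    obtain h where h: "\<And>i. 0 < h $ i" "\<And>i. 0 < (B t *v h) $ i"
      using strictly_semimonotone_imp_S[OF semi] by blast
    have Z: "Z_matrix (B t ** X)"
      using ZX ZY t by (auto simp: Z_matrix_def B_X mult_nonneg_nonpos intro!: add_nonpos_nonpos)
    obtain v where "\<And>i. 0 \<le> v $ i" "X *v v = h"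
      using hidden_Z_nonneg_preimage[OF ZX Z r s pos' h] by blast
    then show ?thesis
      using hidden_Z_no_sign_reversal[OF ZX Z _ _ _ x, of v] h by simp
  qed
  note vertex = LCP_solution_vertex[OF assms(3)]
  have unique: "z1 = z2" if z1: "LCP_solution q A z1" and z2: "LCP_solution q A z2" for z1 z2
  proof -
    define w where "w z = q + A *v z" for z
    define supp :: "real ^ 'n \<Rightarrow> 'n set" where "supp z = {j. 0 < z $ j}" for z
    let ?M = "\<lambda>z. complementary_matrix (supp z) A"
    \<comment> \<open>By complementarity \<open>z + w z\<close> lists the basic variables:
      \<open>z\<close> on the support, \<open>w z\<close> off it.\<close>
    have M: "?M z *v (z + w z) = q" if z: "LCP_solution q A z" for z
    proof -
      note sol = LCP_solutionD[OF z, folded w_def]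
      have "0 < z $ j \<Longrightarrow> w z $ j = 0" "\<not> 0 < z $ j \<Longrightarrow> z $ j = 0" for j
        using sol(1,3)[of j] by auto
      then have "(\<chi> j. if j \<in> supp z then 0 else (z + w z) $ j) = w z"
        "(\<chi> j. if j \<in> supp z then (z + w z) $ j else 0) = z"
        by (auto simp: vec_eq_iff supp_def)
      then show ?thesis
        by (simp add: complementary_matrix_mult) (simp add: w_def)
    qed
    have perturb: "\<forall>\<^sub>F t in at_right 0.
        \<exists>y. complementary_matrix (supp z) (B t) *v y = q \<and> (\<forall>i. 0 < y $ i)"
      if z: "LCP_solution q A z" for z
    proof (rule eventually_perturbed_system_pos[OF _ M[OF z]])
      show "invertible (?M z)"
        using vertex(2)[OF _ z] by (simp add: supp_def)
      show "0 < (z + w z) $ i" for i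
        using vertex(1)[OF _ z] by (simp add: nondegenerate_vector_def w_def)
      show "((\<lambda>t. complementary_matrix (supp z) (B t)) \<longlongrightarrow> ?M z) (at_right 0)"
        by (intro vec_tendstoI) (auto simp: complementary_matrix_def intro!: tendsto_intros B_lim)
    qed
    have "\<forall>\<^sub>F t::real in at_right 0. 0 < t"
      by (rule eventually_at_right_less)
    then have ev: "\<forall>\<^sub>F t in at_right 0. 0 < t \<and> (\<forall>j. 0 < (r v* X + s v* (B t ** X)) $ j) \<and>
        (\<exists>y. complementary_matrix (supp z1) (B t) *v y = q \<and> (\<forall>i. 0 < y $ i)) \<and>
        (\<exists>y. complementary_matrix (supp z2) (B t) *v y = q \<and> (\<forall>i. 0 < y $ i))"
      by (intro eventually_conj pos_B perturb z1 z2)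
    obtain t y1 y2 where t: "0 < t" "\<And>j. 0 < (r v* X + s v* (B t ** X)) $ j"
      and y1: "complementary_matrix (supp z1) (B t) *v y1 = q" "\<And>i. 0 < y1 $ i"
      and y2: "complementary_matrix (supp z2) (B t) *v y2 = q" "\<And>i. 0 < y2 $ i"
      using eventually_happens'[OF trivial_limit_at_right_real ev] by blast
    define zz ww :: "real ^ 'n \<Rightarrow> real ^ 'n \<Rightarrow> real ^ 'n"
      where "zz z y = (\<chi> j. if j \<in> supp z then y $ j else 0)"
        and "ww z y = (\<chi> j. if j \<in> supp z then 0 else y $ j)" for z y
    have "B t *v zz z1 y1 = ww z1 y1 - q" "B t *v zz z2 y2 = ww z2 y2 - q"
      using y1(1) y2(1) by (auto simp: complementary_matrix_mult zz_def ww_def algebra_simps)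
    then have "B t *v (zz z1 y1 - zz z2 y2) = ww z1 y1 - ww z2 y2"
      by (simp add: matrix_vector_mult_diff_distrib)
    \<comment> \<open>Both pairs are nonnegative and complementary, so only the two cross terms,
      with negative sign, remain in each product.\<close>
    then have "zz z1 y1 - zz z2 y2 = 0"
      using y1(2) y2(2)
      by (intro no_reversal[OF t])
        (auto simp: zz_def ww_def less_imp_le mult_nonneg_nonpos mult_nonpos_nonneg)
    then have zz_eq: "zz z1 y1 $ j = zz z2 y2 $ j" for j by simp
    have supp_zz: "j \<in> supp z1 \<longleftrightarrow> 0 < zz z1 y1 $ j" "j \<in> supp z2 \<longleftrightarrow> 0 < zz z2 y2 $ j" for j
      using y1(2) y2(2) by (auto simp: zz_def)
    have supp_eq: "supp z1 = supp z2"
      by (rule set_eqI) (simp only: supp_zz zz_eq)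
    \<comment> \<open>Equal supports give one invertible system for both sums
      \<open>z + w z\<close>; the common support then separates \<open>z\<close> from
      \<open>w z\<close>.\<close>
    have "inj ((*v) (?M z2))"
      using vertex(2)[OF _ z2]
      by (simp add: supp_def invertible_left_inverse matrix_left_invertible_injective)
    moreover have "?M z2 *v (z1 + w z1) = ?M z2 *v (z2 + w z2)"
      using M[OF z1] M[OF z2] by (simp add: supp_eq)
    ultimately have eq: "z1 + w z1 = z2 + w z2"
      by (simp add: inj_eq)
    note sol1 = LCP_solutionD[OF z1, folded w_def] and sol2 = LCP_solutionD[OF z2, folded w_def]
    have "z1 $ j = z2 $ j" for j
    proof (cases "j \<in> supp z1")
      case True
      then have "0 < z1 $ j" "0 < z2 $ j"
        using supp_eq by (auto simp: supp_def)
      then have "w z1 $ j = 0" "w z2 $ j = 0"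
        using sol1(3)[of j] sol2(3)[of j] by auto
      then show ?thesis using arg_cong[OF eq, of "\<lambda>x. x $ j"] by simp
    next
      case False
      then have "\<not> 0 < z1 $ j" "\<not> 0 < z2 $ j"
        using supp_eq by (auto simp: supp_def)
      then show ?thesis
        using sol1(1)[of j] sol2(1)[of j] by simp
    qed
    then show ?thesis by (simp add: vec_eq_iff)
  qed
  show ?thesis
    using assms(4) unique vertex(1) by blast
qed

end
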